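(* Let $P=\frac1{2^3}\delta_1+\frac1{2^2}\delta_2+\frac12\delta_3+\sum_{j=4}^\infty\frac1{2^j}\delta_j$. The set $\{Av[1,2],Av[3,4],Av[5,\infty)\}$ forms the optimal set of three-means for $P$ with quantization error $V_3(P)=\frac{19}{72}$.
   Context: $\delta_x$ denotes the Dirac measure at $x\in\mathbb R$. For a Borel probability measure $P$ on $\mathbb R$ and a nonempty finite set $\alpha\subset\mathbb R$, the distortion error is $V(P;\alpha)=\int\min_{a\in\alpha}|x-a|^2\,dP(x)$. The $n$th quantization error is $V_n(P)=\inf\{V(P;\alpha):\alpha\subset\mathbb R,\ 1\le\mathrm{card}(\alpha)\le n\}$. An optimal set of $n$-means for $P$ is a set $\alpha$ with at most $n$ points for which this infimum is attained. With $p_m=P(\{m\})$ and $i\le\ell$ positive integers, $Av[i,\ell]=\frac{\sum_{m=i}^{\ell}p_m m}{\sum_{m=i}^{\ell}p_m}$ and $Av[i,\infty)=\frac{\sum_{m=i}^{\infty}p_m m}{\sum_{m=i}^{\infty}p_m}$. *)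

theory Defs
  imports "HOL-Probability.Probability"
begin

text \<open>
  The distortion is a nonnegative Lebesgue integral: the Bochner integral of a non-integrable
  function is 0, which would make the infimum below meaningless for measures without a second moment.
\<close>

definition distortion :: "real measure \<Rightarrow> real set \<Rightarrow> ennreal" where
  "distortion P \<alpha> = (\<integral>\<^sup>+ x. ennreal (MIN a\<in>\<alpha>. \<bar>x - a\<bar>\<^sup>2) \<partial>P)"

text \<open>Infinite sets have cardinality 0, so \<open>1 \<le> card \<alpha>\<close> also enforces finiteness.\<close>

definition quantization_error :: "nat \<Rightarrow> real measure \<Rightarrow> ennreal" where
  "quantization_error n P = (INF \<alpha>\<in>{\<alpha>. 1 \<le> card \<alpha> \<and> card \<alpha> \<le> n}. distortion P \<alpha>)"

definition optimal_set_of_means :: "nat \<Rightarrow> real measure \<Rightarrow> real set \<Rightarrow> bool" where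
  "optimal_set_of_means n P \<alpha> \<longleftrightarrow>
     1 \<le> card \<alpha> \<and> card \<alpha> \<le> n \<and> distortion P \<alpha> = quantization_error n P"

definition Av :: "real measure \<Rightarrow> nat \<Rightarrow> nat \<Rightarrow> real" where
  "Av P i l = (\<Sum>m=i..l. measure P {real m} * real m) / (\<Sum>m=i..l. measure P {real m})"

definition Av_inf :: "real measure \<Rightarrow> nat \<Rightarrow> real" where
  "Av_inf P i =
     (\<Sum>\<^sub>\<infinity>m\<in>{i..}. measure P {real m} * real m) / (\<Sum>\<^sub>\<infinity>m\<in>{i..}. measure P {real m})"

definition dirac :: "real \<Rightarrow> real measure" where
  "dirac x = return borel x"

text \<open>
  The tail sum over \<open>j \<ge> 4\<close> is written with the index shifted by 4. There is no addition on
  measures, hence the explicit set function; the lemmas below confirm that it is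
  countably additive, so that it is not replaced by 0 in \<^const>\<open>measure_of\<close>.
\<close>

definition P0 :: "real measure" where
  "P0 = measure_of UNIV (sets borel)
     (\<lambda>A. ennreal (1 / 2 ^ 3) * emeasure (dirac 1) A
        + ennreal (1 / 2 ^ 2) * emeasure (dirac 2) A
        + ennreal (1 / 2) * emeasure (dirac 3) A
        + (\<Sum>j. ennreal (1 / 2 ^ (j + 4)) * emeasure (dirac (real (j + 4))) A))"

lemma space_P0 [simp]: "space P0 = UNIV"
  unfolding P0_def by (simp add: space_measure_of_conv)

lemma sets_P0 [simp, measurable_cong]: "sets P0 = sets borel"
  unfolding P0_def using sets.sigma_sets_eq[of "borel :: real measure"]
  by (simp add: sets_measure_of_conv)

lemma emeasure_P0:
  assumes "A \<in> sets borel"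
  shows "emeasure P0 A =
           ennreal (1 / 2 ^ 3) * emeasure (dirac 1) A
         + ennreal (1 / 2 ^ 2) * emeasure (dirac 2) A
         + ennreal (1 / 2) * emeasure (dirac 3) A
         + (\<Sum>j. ennreal (1 / 2 ^ (j + 4)) * emeasure (dirac (real (j + 4))) A)"
proof (rule emeasure_measure_of[OF P0_def])
  show "sets (borel :: real measure) \<subseteq> Pow UNIV" by simp
  show "A \<in> sets P0" using assms by simp
  show "positive (sets P0) (\<lambda>A. ennreal (1 / 2 ^ 3) * emeasure (dirac 1) A
         + ennreal (1 / 2 ^ 2) * emeasure (dirac 2) A
         + ennreal (1 / 2) * emeasure (dirac 3) A
         + (\<Sum>j. ennreal (1 / 2 ^ (j + 4)) * emeasure (dirac (real (j + 4))) A))"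
    by (simp add: positive_def)
  show "countably_additive (sets P0) (\<lambda>A. ennreal (1 / 2 ^ 3) * emeasure (dirac 1) A
         + ennreal (1 / 2 ^ 2) * emeasure (dirac 2) A
         + ennreal (1 / 2) * emeasure (dirac 3) A
         + (\<Sum>j. ennreal (1 / 2 ^ (j + 4)) * emeasure (dirac (real (j + 4))) A))"
  proof (rule countably_additiveI)
    fix B :: "nat \<Rightarrow> real set"
    assume B: "range B \<subseteq> sets P0" "disjoint_family B"
    have *: "(\<Sum>i. emeasure (dirac x) (B i)) = emeasure (dirac x) (\<Union>i. B i)" for x
      using B by (intro suminf_emeasure) (auto simp: dirac_def)
    have "(\<Sum>i. \<Sum>j. ennreal (1 / 2 ^ (j + 4)) * emeasure (dirac (real (j + 4))) (B i))
        = (\<Sum>j. \<Sum>i. ennreal (1 / 2 ^ (j + 4)) * emeasure (dirac (real (j + 4))) (B i))"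
      using nn_integral_suminf[of "\<lambda>j i. ennreal (1 / 2 ^ (j + 4)) * emeasure (dirac (real (j + 4))) (B i)"
          "count_space UNIV"]
      by (simp add: nn_integral_count_space_nat)
    also have "\<dots> = (\<Sum>j. ennreal (1 / 2 ^ (j + 4)) * emeasure (dirac (real (j + 4))) (\<Union>i. B i))"
      by (simp add: ennreal_suminf_cmult *)
    finally show "(\<Sum>i. ennreal (1 / 2 ^ 3) * emeasure (dirac 1) (B i)
         + ennreal (1 / 2 ^ 2) * emeasure (dirac 2) (B i)
         + ennreal (1 / 2) * emeasure (dirac 3) (B i)
         + (\<Sum>j. ennreal (1 / 2 ^ (j + 4)) * emeasure (dirac (real (j + 4))) (B i)))
       = ennreal (1 / 2 ^ 3) * emeasure (dirac 1) (\<Union>i. B i)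
         + ennreal (1 / 2 ^ 2) * emeasure (dirac 2) (\<Union>i. B i)
         + ennreal (1 / 2) * emeasure (dirac 3) (\<Union>i. B i)
         + (\<Sum>j. ennreal (1 / 2 ^ (j + 4)) * emeasure (dirac (real (j + 4))) (\<Union>i. B i))"
      by (simp add: suminf_add[symmetric] ennreal_suminf_cmult *)
  qed
qed

lemma prob_space_P0: "prob_space P0"
proof
  have "(\<lambda>j. (1 / 2 ^ 4) * (1 / 2) ^ j :: real) sums ((1 / 2 ^ 4) * (1 / (1 - 1 / 2)))"
    by (intro sums_mult geometric_sums) auto
  hence "(\<lambda>j. 1 / 2 ^ (j + 4) :: real) sums (1 / 8)"
    by (simp add: power_add power_one_over field_simps)
  hence t: "(\<Sum>j. ennreal (1 / 2 ^ (j + 4))) = ennreal (1 / 8)"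
    by (intro suminf_ennreal_eq) auto
  have "emeasure P0 UNIV = ennreal (1 / 2 ^ 3) + ennreal (1 / 2 ^ 2) + ennreal (1 / 2) + ennreal (1 / 8)"
    by (simp add: emeasure_P0 dirac_def t)
  also have "\<dots> = ennreal (1 / 2 ^ 3 + 1 / 2 ^ 2 + 1 / 2 + 1 / 8)"
    by (simp only: ennreal_plus zero_le_divide_1_iff add_nonneg_nonneg zero_le_power zero_le_numeral)
  also have "\<dots> = 1" by simp
  finally show "emeasure P0 (space P0) = 1" by simp
qed

end

theory Submission
  imports Defs "HOL-Real_Asymp.Real_Asymp"
begin

text \<open>
  Write a set of at most three points as \<open>{a, b, c}\<close> with \<open>a \<le> b \<le> c\<close>. The atoms of \<open>P0\<close> are then
  split by the midpoints of \<open>a, b\<close> and of \<open>b, c\<close> into consecutive blocks, and the distortion is a sum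
  of one quadratic polynomial per block, whose minimum is the unnormalised variance of the block. The tail block
  starting at \<open>m \<ge> 4\<close> is geometric and costs at least \<open>4 / 2 ^ m\<close>. Only the partition
  \<open>{1, 2}, {3, 4}, {5, \<dots>}\<close> reaches \<open>19/72\<close>: in every other case the costs of some of
  the blocks, or of parts of them, already exceed this value.
\<close>

section \<open>\<open>P0\<close> as a discrete measure on the natural numbers\<close>

text \<open>The point 0 carries no mass; giving it weight 0 lets integrals against \<open>P0\<close>
  become series over all of \<open>nat\<close>.\<close>

definition weight :: "nat \<Rightarrow> real" where
  "weight n = (if n = 0 then 0 else if n = 1 then 1 / 8 else if n = 2 then 1 / 4
               else if n = 3 then 1 / 2 else 1 / 2 ^ n)"

lemma weight_nonneg: "weight n \<ge> 0"
  by (simp add: weight_def)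

lemma suminf_split_4:
  fixes f :: "nat \<Rightarrow> ennreal"
  shows "(\<Sum>n. f n) = f 0 + f 1 + f 2 + f 3 + (\<Sum>n. f (n + 4))"
  using suminf_offset[of f 4] by (simp add: eval_nat_numeral add_ac)

text \<open>As the image of a weighted counting measure, \<open>P0\<close> becomes accessible to the
  change-of-variables and density rules.\<close>

lemma P0_eq_distr: "P0 = distr (density (count_space UNIV) (\<lambda>n. ennreal (weight n))) borel real"
proof (rule measure_eqI)
  fix A assume "A \<in> sets P0"
  then have A: "A \<in> sets borel" by simp
  have "emeasure (distr (density (count_space UNIV) (\<lambda>n. ennreal (weight n))) borel real) A
      = (\<Sum>n. ennreal (weight n) * indicator A (real n))"
    using A by (simp add: emeasure_distr emeasure_density nn_integral_count_space_nat
        indicator_def vimage_def)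
  also have "\<dots> = emeasure P0 A"
    by (subst suminf_split_4) (simp add: A emeasure_P0 dirac_def weight_def)
  finally show "emeasure P0 A
      = emeasure (distr (density (count_space UNIV) (\<lambda>n. ennreal (weight n))) borel real) A"
    by (rule sym)
qed simp

lemma nn_integral_P0:
  assumes "f \<in> borel_measurable borel"
  shows "(\<integral>\<^sup>+x. f x \<partial>P0) = (\<Sum>n. ennreal (weight n) * f (real n))"
  using assms
  by (simp add: P0_eq_distr nn_integral_distr nn_integral_density nn_integral_count_space_nat)

lemma measure_P0_of_nat: "measure P0 {real m} = weight m"
proof -
  have "emeasure P0 {real m} = (\<integral>\<^sup>+x. indicator {real m} x \<partial>P0)"
    by (subst nn_integral_indicator) auto
  also have "\<dots> = (\<Sum>n. ennreal (weight n) * indicator {real m} (real n))"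
    by (subst nn_integral_P0) auto
  also have "\<dots> = (\<Sum>n\<in>{m}. ennreal (weight n) * indicator {real m} (real n))"
    by (rule suminf_finite) auto
  finally show ?thesis
    by (simp add: measure_def weight_nonneg)
qed

section \<open>Squared distance to three centres and its summability\<close>

definition sqdist :: "real \<Rightarrow> real \<Rightarrow> real \<Rightarrow> real \<Rightarrow> real" where
  "sqdist a b c x = min ((x - a)\<^sup>2) (min ((x - b)\<^sup>2) ((x - c)\<^sup>2))"

lemma sqdist_nonneg: "sqdist a b c x \<ge> 0"
  by (simp add: sqdist_def)

text \<open>The difference of the squares factors as \<open>(v - u) * (u + v - 2 * x)\<close>, so
  its sign depends on the side of the midpoint on which \<open>x\<close> lies.\<close>

lemma square_dist_le:
  fixes x u v :: real
  assumes "u \<le> v"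
  shows "2 * x \<le> u + v \<Longrightarrow> (x - u)\<^sup>2 \<le> (x - v)\<^sup>2" "u + v \<le> 2 * x \<Longrightarrow> (x - v)\<^sup>2 \<le> (x - u)\<^sup>2"
proof -
  have *: "(x - v)\<^sup>2 - (x - u)\<^sup>2 = (v - u) * (u + v - 2 * x)"
    by (simp add: power2_eq_square algebra_simps)
  show "(x - u)\<^sup>2 \<le> (x - v)\<^sup>2" if "2 * x \<le> u + v"
    using * assms that mult_nonneg_nonneg[of "v - u" "u + v - 2 * x"] by linarith
  show "(x - v)\<^sup>2 \<le> (x - u)\<^sup>2" if "u + v \<le> 2 * x"
    using * assms that mult_nonneg_nonpos[of "v - u" "u + v - 2 * x"] by linarith
qed

text \<open>By \<open>b \<le> c\<close>, the bound \<open>2 * x \<le> a + b\<close> also gives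
  \<open>2 * x \<le> a + c\<close>. The bound is not strict: a point equidistant from two centres
  may be assigned to either, so later cases may overlap.\<close>

lemma sqdist_left:
  assumes "a \<le> b" "b \<le> c" "2 * x \<le> a + b"
  shows "sqdist a b c x = (x - a)\<^sup>2"
  using square_dist_le(1)[of a b x] square_dist_le(1)[of a c x] assms
  by (simp add: sqdist_def)

lemma sqdist_middle:
  assumes "a \<le> b" "b \<le> c" "a + b \<le> 2 * x" "2 * x \<le> b + c"
  shows "sqdist a b c x = (x - b)\<^sup>2"
  using square_dist_le(2)[of a b x] square_dist_le(1)[of b c x] assms
  by (simp add: sqdist_def)

lemma sqdist_right:
  assumes "a \<le> b" "b \<le> c" "b + c \<le> 2 * x"
  shows "sqdist a b c x = (x - c)\<^sup>2"
  using square_dist_le(2)[of a c x] square_dist_le(2)[of b c x] assms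
  by (simp add: sqdist_def)

text \<open>The telescoping sequence comes from \<open>\<Sum>i. (s + i)\<^sup>2 / 2 ^ i = 2 * s\<^sup>2 + 4 * s + 6\<close>.\<close>

lemma geometric_square_sums:
  fixes c :: real
  shows "(\<lambda>j. (real (j + m) - c)\<^sup>2 / 2 ^ (j + m)) sums ((2 * (real m + 1 - c)\<^sup>2 + 4) / 2 ^ m)"
proof -
  define F where "F j = (2 * (real (j + m) + 1 - c)\<^sup>2 + 4) / 2 ^ (j + m)" for j
  have "F \<longlonglongrightarrow> 0"
    unfolding F_def by real_asymp
  then have "(\<lambda>j. F j - F (Suc j)) sums (F 0 - 0)"
    by (rule telescope_sums')
  moreover have "F j - F (Suc j) = (real (j + m) - c)\<^sup>2 / 2 ^ (j + m)" for j
    by (simp add: F_def field_simps power2_eq_square)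
  ultimately show ?thesis
    by (simp add: F_def)
qed

text \<open>The distance to the single centre \<open>c\<close> dominates, and its series has a
  closed form.\<close>

lemma summable_sqdist: "summable (\<lambda>j. sqdist a b c (real (j + m)) / 2 ^ (j + m))"
proof (rule summable_comparison_test')
  show "summable (\<lambda>j. (real (j + m) - c)\<^sup>2 / 2 ^ (j + m))"
    using geometric_square_sums by (rule sums_summable)
  show "norm (sqdist a b c (real (j + m)) / 2 ^ (j + m)) \<le> (real (j + m) - c)\<^sup>2 / 2 ^ (j + m)"
    for j
  proof -
    have "sqdist a b c (real (j + m)) \<le> (real (j + m) - c)\<^sup>2"
      by (simp add: sqdist_def)
    then show ?thesis
      by (simp add: sqdist_nonneg divide_right_mono del: of_nat_add)
  qed
qed

section \<open>Cost of the tail and of all atoms\<close>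

text \<open>The weights are purely geometric, so this is the contribution of the atoms from
  \<open>m\<close> on only for \<open>m \<ge> 4\<close>.\<close>

definition tail_cost :: "real \<Rightarrow> real \<Rightarrow> real \<Rightarrow> nat \<Rightarrow> real" where
  "tail_cost a b c m = (\<Sum>j. sqdist a b c (real (j + m)) / 2 ^ (j + m))"

lemma tail_cost_nonneg: "tail_cost a b c m \<ge> 0"
  unfolding tail_cost_def by (intro suminf_nonneg summable_sqdist) (simp add: sqdist_nonneg)

lemma tail_cost_Suc: "tail_cost a b c m = sqdist a b c (real m) / 2 ^ m + tail_cost a b c (Suc m)"
  using suminf_split_head[OF summable_sqdist[of a b c m]] by (simp add: tail_cost_def)

text \<open>The centre \<open>c\<close> serves every atom from \<open>m\<close> on. The geometric
  tail has mass \<open>2 / 2 ^ m\<close>, mean \<open>m + 1\<close> and variance 2.\<close>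

lemma tail_cost_eq:
  assumes "a \<le> b" "b \<le> c" "b + c \<le> 2 * real m"
  shows "tail_cost a b c m = (2 * (real m + 1 - c)\<^sup>2 + 4) / 2 ^ m"
proof -
  have "sqdist a b c (real (j + m)) = (real (j + m) - c)\<^sup>2" for j
    using assms by (intro sqdist_right) auto
  then show ?thesis
    using sums_unique[OF geometric_square_sums[of m c]] by (simp add: tail_cost_def)
qed

lemma tail_cost_ge:
  assumes "a \<le> b" "b \<le> c" "b + c \<le> 2 * real m"
  shows "tail_cost a b c m \<ge> 4 / 2 ^ m"
  by (simp add: tail_cost_eq[OF assms] divide_right_mono)

definition total_cost :: "real \<Rightarrow> real \<Rightarrow> real \<Rightarrow> real" where
  "total_cost a b c = sqdist a b c 1 / 8 + sqdist a b c 2 / 4 + sqdist a b c 3 / 2 + tail_cost a b c 4"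

lemma total_cost_nonneg: "total_cost a b c \<ge> 0"
  by (simp add: total_cost_def sqdist_nonneg tail_cost_nonneg)

text \<open>Coinciding points are allowed, so this also covers sets with one or two
  elements.\<close>

lemma distortion_P0: "distortion P0 {a, b, c} = ennreal (total_cost a b c)"
proof -
  have "(MIN y\<in>{a, b, c}. \<bar>x - y\<bar>\<^sup>2) = sqdist a b c x" for x :: real
    by (simp add: sqdist_def)
  then have "distortion P0 {a, b, c} = (\<integral>\<^sup>+x. ennreal (sqdist a b c x) \<partial>P0)"
    by (simp add: distortion_def)
  also have "\<dots> = (\<Sum>n. ennreal (weight n) * ennreal (sqdist a b c (real n)))"
    by (rule nn_integral_P0) (simp add: sqdist_def[abs_def])
  also have "\<dots> = (\<Sum>n. ennreal (weight n * sqdist a b c (real n)))"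
    by (simp add: ennreal_mult weight_nonneg sqdist_nonneg)
  also have "\<dots> = ennreal (sqdist a b c 1 / 8) + ennreal (sqdist a b c 2 / 4)
      + ennreal (sqdist a b c 3 / 2) + (\<Sum>j. ennreal (sqdist a b c (real (j + 4)) / 2 ^ (j + 4)))"
    by (subst suminf_split_4) (simp add: weight_def)
  also have "(\<Sum>j. ennreal (sqdist a b c (real (j + 4)) / 2 ^ (j + 4))) = ennreal (tail_cost a b c 4)"
    unfolding tail_cost_def
    by (intro suminf_ennreal2 summable_sqdist) (simp add: sqdist_nonneg)
  finally show ?thesis
    by (simp add: total_cost_def sqdist_nonneg tail_cost_nonneg flip: ennreal_plus)
qed

section \<open>Comparison of the partitions\<close>

text \<open>The bounds assign 1, 2 to \<open>a\<close>, then 3, 4 to \<open>b\<close>, and the rest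
  to \<open>c\<close>. Completing the square in each block gives its mass as coefficient and its
  mean as centre; the constant is \<open>1 / 12 + 1 / 18 + 1 / 8\<close>.\<close>

lemma optimal_blocks:
  fixes a b c :: real
  assumes "a \<le> b" "b \<le> c" "4 \<le> a + b" "a + b \<le> 6" "8 \<le> b + c" "b + c \<le> 10"
  shows "total_cost a b c
       = 19 / 72 + 3 / 8 * (a - 5 / 3)\<^sup>2 + 9 / 16 * (b - 28 / 9)\<^sup>2 + 1 / 16 * (c - 6)\<^sup>2"
proof -
  \<comment> \<open>The atom 4 is split off because \<open>b\<close> serves it.\<close>
  have "tail_cost a b c 4 = (4 - b)\<^sup>2 / 16 + (2 * (6 - c)\<^sup>2 + 4) / 32"
    using assms tail_cost_Suc[of a b c 4] tail_cost_eq[of a b c 5] sqdist_middle[of a b c 4] by simp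
  moreover have "sqdist a b c 1 = (1 - a)\<^sup>2" "sqdist a b c 2 = (2 - a)\<^sup>2" "sqdist a b c 3 = (3 - b)\<^sup>2"
    using assms by (simp_all add: sqdist_left sqdist_middle)
  ultimately show ?thesis
    by (simp add: total_cost_def power2_eq_square field_simps)
qed

lemma other_blocks:
  fixes a b c :: real
  assumes le: "a \<le> b" "b \<le> c"
    and other: "\<not> (4 \<le> a + b \<and> a + b \<le> 6 \<and> 8 \<le> b + c \<and> b + c \<le> 10)"
  shows "total_cost a b c > 19 / 72"
proof -
  note left = sqdist_left[OF le] and middle = sqdist_middle[OF le] and right = sqdist_right[OF le]
  note nonneg = sqdist_nonneg[of a b c 1] sqdist_nonneg[of a b c 2] sqdist_nonneg[of a b c 3]
    sqdist_nonneg[of a b c 4] sqdist_nonneg[of a b c 5] sqdist_nonneg[of a b c 6]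
    tail_cost_nonneg[of a b c 4] tail_cost_nonneg[of a b c 5] tail_cost_nonneg[of a b c 6]
    tail_cost_nonneg[of a b c 7]
  have tail: "tail_cost a b c 4 = sqdist a b c 4 / 16 + tail_cost a b c 5"
    "tail_cost a b c 5 = sqdist a b c 5 / 32 + tail_cost a b c 6"
    "tail_cost a b c 6 = sqdist a b c 6 / 64 + tail_cost a b c 7"
    using tail_cost_Suc[of a b c 4] tail_cost_Suc[of a b c 5] tail_cost_Suc[of a b c 6] by simp_all
  \<comment> \<open>Each \<open>var\<close> fact completes the square at the weighted mean of a
    block; the constant is the unnormalised variance.\<close>
  have var_12: "(1 - x)\<^sup>2 / 8 + (2 - x)\<^sup>2 / 4 \<ge> 1 / 12" for x :: real
  proof -
    have "(1 - x)\<^sup>2 / 8 + (2 - x)\<^sup>2 / 4 = 3 / 8 * (x - 5 / 3)\<^sup>2 + 1 / 12"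
      by (simp add: power2_eq_square field_simps)
    then show ?thesis by simp
  qed
  have var_123: "(1 - x)\<^sup>2 / 8 + (2 - x)\<^sup>2 / 4 + (3 - x)\<^sup>2 / 2 \<ge> 13 / 28" for x :: real
  proof -
    have "(1 - x)\<^sup>2 / 8 + (2 - x)\<^sup>2 / 4 + (3 - x)\<^sup>2 / 2 = 7 / 8 * (x - 17 / 7)\<^sup>2 + 13 / 28"
      by (simp add: power2_eq_square field_simps)
    then show ?thesis by simp
  qed
  have var_23: "(2 - x)\<^sup>2 / 4 + (3 - x)\<^sup>2 / 2 \<ge> 1 / 6" for x :: real
  proof -
    have "(2 - x)\<^sup>2 / 4 + (3 - x)\<^sup>2 / 2 = 3 / 4 * (x - 8 / 3)\<^sup>2 + 1 / 6"
      by (simp add: power2_eq_square field_simps)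
    then show ?thesis by simp
  qed
  have var_234: "(2 - x)\<^sup>2 / 4 + (3 - x)\<^sup>2 / 2 + (4 - x)\<^sup>2 / 16 \<ge> 7 / 26" for x :: real
  proof -
    have "(2 - x)\<^sup>2 / 4 + (3 - x)\<^sup>2 / 2 + (4 - x)\<^sup>2 / 16 = 13 / 16 * (x - 36 / 13)\<^sup>2 + 7 / 26"
      by (simp add: power2_eq_square field_simps)
    then show ?thesis by simp
  qed
  have var_345: "(3 - x)\<^sup>2 / 2 + (4 - x)\<^sup>2 / 16 + (5 - x)\<^sup>2 / 32 \<ge> 49 / 304" for x :: real
  proof -
    have "(3 - x)\<^sup>2 / 2 + (4 - x)\<^sup>2 / 16 + (5 - x)\<^sup>2 / 32 = 19 / 32 * (x - 61 / 19)\<^sup>2 + 49 / 304"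
      by (simp add: power2_eq_square field_simps)
    then show ?thesis by simp
  qed
  have var_3456: "(3 - x)\<^sup>2 / 2 + (4 - x)\<^sup>2 / 16 + (5 - x)\<^sup>2 / 32 + (6 - x)\<^sup>2 / 64 \<ge> 349 / 1248" for x :: real
  proof -
    have "(3 - x)\<^sup>2 / 2 + (4 - x)\<^sup>2 / 16 + (5 - x)\<^sup>2 / 32 + (6 - x)\<^sup>2 / 64
        = 39 / 64 * (x - 128 / 39)\<^sup>2 + 349 / 1248"
      by (simp add: power2_eq_square field_simps)
    then show ?thesis by simp
  qed
  have var_3_inf: "(3 - x)\<^sup>2 / 2 + (2 * (5 - x)\<^sup>2 + 4) / 16 \<ge> 13 / 20" for x :: real
  proof -
    have "(3 - x)\<^sup>2 / 2 + (2 * (5 - x)\<^sup>2 + 4) / 16 = 5 / 8 * (x - 17 / 5)\<^sup>2 + 13 / 20"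
      by (simp add: power2_eq_square field_simps)
    then show ?thesis by simp
  qed
  have tail4: "tail_cost a b c 4 \<ge> 1 / 4" if "b + c \<le> 8"
    using tail_cost_ge[OF le, of 4] that by simp
  have tail6: "tail_cost a b c 6 \<ge> 1 / 16" if "b + c \<le> 12"
    using tail_cost_ge[OF le, of 6] that by simp
  \<comment> \<open>Each label names a centre and atoms that it serves. The only missing range of
    the doubled midpoints is the one excluded by \<open>other\<close>.\<close>
  consider (a123) "6 \<le> a + b" | (c3) "b + c \<le> 6" | (b123) "a + b \<le> 2" "6 \<le> b + c"
    | (b23) "2 \<le> a + b" "a + b \<le> 4" "6 \<le> b + c" "b + c \<le> 8"
    | (b234) "2 \<le> a + b" "a + b \<le> 4" "8 \<le> b + c"
    | (b3) "4 \<le> a + b" "a + b \<le> 6" "6 \<le> b + c" "b + c \<le> 8"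
    | (b345) "4 \<le> a + b" "a + b \<le> 6" "10 \<le> b + c" "b + c \<le> 12"
    | (b3456) "4 \<le> a + b" "a + b \<le> 6" "12 \<le> b + c"
    using other by linarith
  then show ?thesis
  proof cases
    case a123
    then show ?thesis
      using left[of 1] left[of 2] left[of 3] var_123[of a] nonneg unfolding total_cost_def by linarith
  next
    case c3
    \<comment> \<open>The bound \<open>1 / 4\<close> for the tail alone falls short of
      \<open>19 / 72\<close>; the exact formula lets the atom 3 be charged to the same
      \<open>c\<close>.\<close>
    then have "tail_cost a b c 4 = (2 * (5 - c)\<^sup>2 + 4) / 16"
      using tail_cost_eq[OF le, of 4] by simp
    then show ?thesis
      using c3 right[of 3] var_3_inf[of c] nonneg unfolding total_cost_def by linarith
  next
    case b123
    then show ?thesis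
      using middle[of 1] middle[of 2] middle[of 3] var_123[of b] nonneg
      unfolding total_cost_def by linarith
  next
    case b23
    then show ?thesis
      using middle[of 2] middle[of 3] var_23[of b] tail4 nonneg
      unfolding total_cost_def by linarith
  next
    case b234
    \<comment> \<open>This case has the smallest margin:
      \<open>7 / 26 - 19 / 72 = 5 / 936\<close>.\<close>
    then show ?thesis
      using middle[of 2] middle[of 3] middle[of 4] var_234[of b] tail nonneg
      unfolding total_cost_def by linarith
  next
    case b3
    then show ?thesis
      using left[of 1] left[of 2] var_12[of a] tail4 nonneg unfolding total_cost_def by linarith
  next
    case b345
    \<comment> \<open>Three contributions are added:
      \<open>1 / 12 + 49 / 304 + 1 / 16 > 19 / 72\<close>.\<close>
    then show ?thesis
      using left[of 1] left[of 2] var_12[of a] middle[of 3] middle[of 4] middle[of 5]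
        var_345[of b] tail tail6 nonneg
      unfolding total_cost_def by linarith
  next
    case b3456
    \<comment> \<open>Here \<open>b + c\<close> has no upper bound, but the atoms 3 to 6 alone
      already cost at least \<open>349 / 1248 > 19 / 72\<close>.\<close>
    then show ?thesis
      using middle[of 3] middle[of 4] middle[of 5] middle[of 6]
        var_3456[of b] tail nonneg
      unfolding total_cost_def by linarith
  qed
qed

lemma total_cost_ge:
  assumes "a \<le> b" "b \<le> c"
  shows "total_cost a b c \<ge> 19 / 72"
  using optimal_blocks[OF assms] other_blocks[OF assms] by fastforce

text \<open>Strictness in \<open>other_blocks\<close> leaves only the optimal partition, where a
  positive combination of squares must vanish.\<close>

lemma total_cost_minimiser:
  assumes "a \<le> b" "b \<le> c" "total_cost a b c = 19 / 72"
  shows "a = 5 / 3 \<and> b = 28 / 9 \<and> c = 6"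
proof -
  have "19 / 72 = 19 / 72 + 3 / 8 * (a - 5 / 3)\<^sup>2 + 9 / 16 * (b - 28 / 9)\<^sup>2 + 1 / 16 * (c - 6)\<^sup>2"
    using optimal_blocks[OF assms(1,2)] other_blocks[OF assms(1,2)] assms(3) by fastforce
  moreover have "(a - 5 / 3)\<^sup>2 \<ge> 0" "(b - 28 / 9)\<^sup>2 \<ge> 0" "(c - 6)\<^sup>2 \<ge> 0"
    by simp_all
  ultimately have "(a - 5 / 3)\<^sup>2 = 0" "(b - 28 / 9)\<^sup>2 = 0" "(c - 6)\<^sup>2 = 0"
    by linarith+
  then show ?thesis by simp
qed

section \<open>Sorted triples and conditional means\<close>

lemma sorted_three_points:
  fixes \<alpha> :: "'a :: linorder set"
  assumes "1 \<le> card \<alpha>" "card \<alpha> \<le> 3"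
  obtains a b c where "a \<le> b" "b \<le> c" "\<alpha> = {a, b, c}"
proof -
  have "card \<alpha> = 1 \<or> card \<alpha> = 2 \<or> card \<alpha> = 3"
    using assms by linarith
  then obtain x y z where xyz: "\<alpha> = {x, y, z}"
    by (metis card_1_singletonE card_2_iff card_3_iff insert_absorb2)
  define a where "a = min x (min y z)"
  define c where "c = max x (max y z)"
  \<comment> \<open>The median of the three points.\<close>
  define b where "b = max (min x y) (min (max x y) z)"
  have "a \<le> b" "b \<le> c" "\<alpha> = {a, b, c}"
    unfolding xyz a_def b_def c_def by (auto simp: min_def max_def)
  then show ?thesis by (rule that)
qed

lemma Av_P0: "Av P0 1 2 = 5 / 3" "Av P0 3 4 = 28 / 9"
proof -
  have "{1..2::nat} = {1, 2}" "{3..4::nat} = {3, 4}" by auto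
  then show "Av P0 1 2 = 5 / 3" "Av P0 3 4 = 28 / 9"
    by (simp_all add: Av_def measure_P0_of_nat weight_def)
qed

text \<open>Nonnegativity makes the convergence absolute, as the unordered sum requires.\<close>

lemma infsum_atLeast_eqI:
  fixes f :: "nat \<Rightarrow> real"
  assumes "(\<lambda>j. f (j + m)) sums s" "\<And>j. f (j + m) \<ge> 0"
  shows "infsum f {m..} = s"
proof -
  have "((\<lambda>j. f (j + m)) has_sum s) UNIV"
    using assms by (intro norm_summable_imp_has_sum) (simp_all add: sums_iff)
  moreover have "bij_betw (\<lambda>j. j + m) UNIV {m..}"
    by (rule bij_betw_byWitness[where f' = "\<lambda>j. j - m"]) auto
  ultimately have "(f has_sum s) {m..}"
    using has_sum_reindex_bij_betw[of "\<lambda>j. j + m" UNIV "{m..}" f s] by simp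
  then show ?thesis by (rule infsumI)
qed

lemma Av_inf_P0: "Av_inf P0 5 = 6"
proof -
  \<comment> \<open>The telescoping sequence is the remainder of the series of
    \<open>n / 2 ^ n\<close> from \<open>n = j + 5\<close> on; the one for the masses below arises
    in the same way.\<close>
  have "(\<lambda>j. real (j + 6) / 2 ^ (j + 4)) \<longlonglongrightarrow> 0"
    by real_asymp
  from telescope_sums'[OF this]
  have "(\<lambda>j. real (j + 6) / 2 ^ (j + 4) - real (Suc j + 6) / 2 ^ (Suc j + 4)) sums (6 / 16)"
    by simp
  moreover have "real (j + 6) / 2 ^ (j + 4) - real (Suc j + 6) / 2 ^ (Suc j + 4)
      = weight (j + 5) * real (j + 5)" for j
    by (simp add: weight_def power_add divide_simps)
  ultimately have "(\<lambda>j. weight (j + 5) * real (j + 5)) sums (6 / 16)"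
    by simp
  then have num: "(\<Sum>\<^sub>\<infinity>m\<in>{5..}. weight m * real m) = 6 / 16"
    by (rule infsum_atLeast_eqI) (simp add: weight_nonneg)
  have "(\<lambda>j. 1 / 2 ^ (j + 4) :: real) \<longlonglongrightarrow> 0"
    by real_asymp
  from telescope_sums'[OF this]
  have "(\<lambda>j. weight (j + 5)) sums (1 / 16)"
    by (simp add: weight_def power_add field_simps)
  then have den: "(\<Sum>\<^sub>\<infinity>m\<in>{5..}. weight m) = 1 / 16"
    by (rule infsum_atLeast_eqI) (simp add: weight_nonneg)
  show ?thesis
    by (simp add: Av_inf_def measure_P0_of_nat num den)
qed

theorem proposition4p2p2:
  shows "optimal_set_of_means 3 P0 {Av P0 1 2, Av P0 3 4, Av_inf P0 5}
       \<and> (\<forall>\<alpha>. optimal_set_of_means 3 P0 \<alpha> \<longrightarrow> \<alpha> = {Av P0 1 2, Av P0 3 4, Av_inf P0 5})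
       \<and> quantization_error 3 P0 = ennreal (19 / 72)"
proof -
  define \<beta> :: "real set" where "\<beta> = {5 / 3, 28 / 9, 6}"
  have card: "card \<beta> = 3"
    by (simp add: \<beta>_def)
  have dist: "distortion P0 \<beta> = ennreal (19 / 72)"
    unfolding \<beta>_def distortion_P0 by (simp add: optimal_blocks)
  have error: "quantization_error 3 P0 = ennreal (19 / 72)"
    unfolding quantization_error_def
  proof (rule antisym)
    show "(INF \<alpha>\<in>{\<alpha>. 1 \<le> card \<alpha> \<and> card \<alpha> \<le> 3}. distortion P0 \<alpha>) \<le> ennreal (19 / 72)"
      using card by (intro INF_lower2[of \<beta>]) (auto simp: dist)
    show "ennreal (19 / 72) \<le> (INF \<alpha>\<in>{\<alpha>. 1 \<le> card \<alpha> \<and> card \<alpha> \<le> 3}. distortion P0 \<alpha>)"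
    proof (rule INF_greatest, clarify)
      fix \<alpha> :: "real set" assume "1 \<le> card \<alpha>" "card \<alpha> \<le> 3"
      then obtain a b c where "a \<le> b" "b \<le> c" "\<alpha> = {a, b, c}"
        by (rule sorted_three_points)
      then show "ennreal (19 / 72) \<le> distortion P0 \<alpha>"
        using total_cost_ge[of a b c] by (simp only: distortion_P0 ennreal_leI)
    qed
  qed
  have "\<alpha> = \<beta>" if "optimal_set_of_means 3 P0 \<alpha>" for \<alpha>
  proof -
    have \<alpha>: "1 \<le> card \<alpha>" "card \<alpha> \<le> 3" "distortion P0 \<alpha> = ennreal (19 / 72)"
      using that by (simp_all add: optimal_set_of_means_def error)
    from \<alpha>(1,2) obtain a b c where abc: "a \<le> b" "b \<le> c" "\<alpha> = {a, b, c}"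
      by (rule sorted_three_points)
    with \<alpha>(3) have "total_cost a b c = 19 / 72"
      \<comment> \<open>Both reals are nonnegative, so equality of their \<open>ennreal\<close>
        images carries back.\<close>
      by (simp add: distortion_P0 total_cost_nonneg)
    then have "a = 5 / 3 \<and> b = 28 / 9 \<and> c = 6"
      using abc by (intro total_cost_minimiser)
    then show ?thesis
      by (simp only: abc \<beta>_def)
  qed
  moreover have "optimal_set_of_means 3 P0 \<beta>"
    using card by (simp add: optimal_set_of_means_def dist error)
  ultimately show ?thesis
    using error unfolding \<beta>_def Av_P0 Av_inf_P0 by blast
qed

end
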